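(* Let $u\in\mathbb{Z}_{\ge 0}^m$ be a vector of counts with $n := \sum_{j=1}^m u_j\ge 1$, and let $A\in\mathbb{Z}^{d\times m}$ be a matrix whose row span contains the all-ones vector. Then the MLE given $u$ in the log-linear model $\mathcal{M}_A$ exists if and only if there is some $b\in\mathbb{Z}^d$, of the form $b = Av$ for some $v\in\mathbb{R}_{>0}^m$, such that $u$ (viewed as a vector in $\mathbb{C}^m$) is semistable for the action of the complex torus $(\mathbb{C}^\times)^d$ on $\mathbb{C}^m$ given by the matrix $nA$ with linearization $b$.
   Context: Torus action: for $B = (B_{ij}) \in \mathbb{Z}^{d\times m}$ and $b \in \mathbb{Z}^d$, the action of $(\mathbb{C}^\times)^d$ on $\mathbb{C}^m$ given by the matrix $B$ with linearization $b$ is $(\lambda\cdot w)_j = \lambda_1^{B_{1j}-b_1}\cdots\lambda_d^{B_{dj}-b_d}\, w_j$ for $\lambda\in(\mathbb{C}^\times)^d$, $w \in \mathbb{C}^m$. A vector $w$ is semistable if $0$ is not in the Euclidean closure of its orbit. Log-linear model: $\Delta_{m-1} = \{p\in\mathbb{R}^m : p_j\ge 0 \text{ for all } j,\ \sum_j p_j = 1\}$, and $\mathcal{M}_A = \{p\in\Delta_{m-1} : p_j > 0 \text{ for all } j,\ \log p \in \mathrm{rowspan}(A)\}$, where $\log$ is applied coordinatewise and the row span is over $\mathbb{R}$. An MLE given $u$ in $\mathcal{M}_A$ is a maximizer over $\mathcal{M}_A$ of the likelihood function $L_u(p) = p_1^{u_1}\cdots p_m^{u_m}$. *)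

theory Defs
  imports "HOL-Analysis.Analysis"
begin

text \<open>
  Vectors and matrices are indexed by finite types: \<open>'d\<close> for the rows and \<open>'m\<close> for the
  columns, so a \<open>d \<times> m\<close> matrix has type \<open>'a ^ 'm ^ 'd\<close>.
\<close>

definition complex_torus :: "(complex ^ 'd) set" where
  "complex_torus = {t. \<forall>i. t $ i \<noteq> 0}"

definition torus_act ::
    "int ^ 'm ^ 'd \<Rightarrow> int ^ 'd \<Rightarrow> complex ^ 'd \<Rightarrow> complex ^ 'm \<Rightarrow> complex ^ 'm" where
  "torus_act B b t w = (\<chi> j. (\<Prod>i\<in>UNIV. (t $ i) powi (B $ i $ j - b $ i)) * w $ j)"

definition torus_orbit ::
    "int ^ 'm ^ 'd \<Rightarrow> int ^ 'd \<Rightarrow> complex ^ 'm \<Rightarrow> (complex ^ 'm) set" where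
  "torus_orbit B b w = (\<lambda>t. torus_act B b t w) ` complex_torus"

definition semistable :: "int ^ 'm ^ 'd \<Rightarrow> int ^ 'd \<Rightarrow> complex ^ 'm \<Rightarrow> bool" where
  "semistable B b w \<longleftrightarrow> 0 \<notin> closure (torus_orbit B b w)"

definition rowspan :: "int ^ 'm ^ 'd \<Rightarrow> (real ^ 'm) set" where
  "rowspan A = span (rows (map_matrix real_of_int A))"

definition prob_simplex :: "(real ^ 'm) set" where
  "prob_simplex = {p. (\<forall>j. p $ j \<ge> 0) \<and> (\<Sum>j\<in>UNIV. p $ j) = 1}"

definition log_linear_model :: "int ^ 'm ^ 'd \<Rightarrow> (real ^ 'm) set" where
  "log_linear_model A =
     {p \<in> prob_simplex. (\<forall>j. p $ j > 0) \<and> (\<chi> j. ln (p $ j)) \<in> rowspan A}"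

definition likelihood :: "nat ^ 'm \<Rightarrow> real ^ 'm \<Rightarrow> real" where
  "likelihood u p = (\<Prod>j\<in>UNIV. (p $ j) ^ (u $ j))"

definition is_MLE :: "int ^ 'm ^ 'd \<Rightarrow> nat ^ 'm \<Rightarrow> real ^ 'm \<Rightarrow> bool" where
  "is_MLE A u p \<longleftrightarrow> is_arg_max (likelihood u) (\<lambda>q. q \<in> log_linear_model A) p"

end

theory Submission
  imports Defs
begin

text \<open>
  By a separation argument \<open>w\<close> is semistable iff \<open>b\<close> is a convex combination of the columns of
  the weight matrix that are indexed by the support of \<open>w\<close>. The likelihood has a maximizer iff
  some strictly positive vector has the same image under \<open>A\<close> as \<open>u\<close>: the critical point
  equation at a maximizer \<open>p\<close> says \<open>A u = n A p\<close>; conversely, on the model \<open>u\<close> may be replaced by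
  the positive vector, which makes the superlevel sets of the log-likelihood compact.
  If \<open>b = A v\<close> with \<open>v > 0\<close> and \<open>b = A w\<close> with \<open>w \<ge> 0\<close> supported in the support of \<open>u\<close>, then
  \<open>u + \<epsilon> (v - w)\<close> is such a positive vector for small \<open>\<epsilon> > 0\<close>.
\<close>

section \<open>Semistability of torus actions\<close>

text \<open>Distance to 0 depends only on moduli, and in terms of \<open>ln (norm (t $ i))\<close>
  these are exponentials of linear forms, so only real convex geometry remains.\<close>

lemma norm_torus_act:
  fixes B :: "int ^ 'm::finite ^ 'd::finite"
  assumes "t \<in> complex_torus"
  shows "norm (torus_act B b t w $ j) =
    exp ((\<chi> i. ln (norm (t $ i))) \<bullet>
      (\<chi> i. real_of_int (B $ i $ j - b $ i))) * norm (w $ j)"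
proof -
  have "norm ((t $ i) powi k) = exp (ln (norm (t $ i)) * real_of_int k)" for i k
    using assms
    by (simp add: complex_torus_def norm_power_int powr_real_of_int'[symmetric] powr_def mult.commute)
  then show ?thesis
    by (simp add: torus_act_def norm_mult prod_norm[symmetric] inner_vec_def exp_sum del: of_int_diff)
qed

text \<open>The geometric mean of the moduli with weights q is continuous and constant on the orbit,
  since the weights shifted by b average to zero under q. It vanishes at 0 but not at w.\<close>

lemma weight_hull_imp_semistable:
  fixes B :: "int ^ 'm::finite ^ 'd::finite" and w :: "complex ^ 'm"
  assumes q: "q \<in> prob_simplex" and supp: "\<And>j. w $ j = 0 \<Longrightarrow> q $ j = 0"
    and Bq: "map_matrix real_of_int B *v q = (\<chi> i. real_of_int (b $ i))"
  shows "semistable B b w"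
proof -
  \<comment> \<open>Indices with zero exponent are left out: \<open>0 powr 0 = 0\<close>, so such a
    factor could wrongly vanish at w and break continuity.\<close>
  define S where "S = {j. q $ j > 0}"
  define G where "G z = (\<Prod>j\<in>S. norm (z $ j) powr (q $ j))" for z :: "complex ^ 'm"
  have q0: "\<And>j. q $ j \<ge> 0" and q1: "(\<Sum>j\<in>UNIV. q $ j) = 1"
    using q by (auto simp: prob_simplex_def)
  have "S \<noteq> {}"
  proof
    assume "S = {}"
    then have "q $ j = 0" for j
      using q0[of j] by (auto simp: S_def less_le)
    then show False using q1 by simp
  qed
  have "continuous_on UNIV G"
    unfolding G_def S_def by (auto intro!: continuous_intros continuous_on_powr')
  moreover have "G z = G w" if "z \<in> torus_orbit B b w" for z
  proof -
    obtain t where t: "t \<in> complex_torus" "z = torus_act B b t w"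
      using \<open>z \<in> torus_orbit B b w\<close> by (auto simp: torus_orbit_def)
    define a :: "real ^ 'd" where "a = (\<chi> i. ln (norm (t $ i)))"
    define c :: "'m \<Rightarrow> real ^ 'd" where "c j = (\<chi> i. real_of_int (B $ i $ j - b $ i))" for j
    \<comment> \<open>As q sums to 1, the linearization is subtracted exactly once.\<close>
    have "(\<Sum>j\<in>UNIV. q $ j *\<^sub>R c j) = map_matrix real_of_int B *v q - (\<chi> i. real_of_int (b $ i))"
    proof (rule vec_eq_iff[THEN iffD2], rule allI)
      fix i
      have "(\<Sum>j\<in>UNIV. q $ j *\<^sub>R c j) $ i =
          (\<Sum>j\<in>UNIV. real_of_int (B $ i $ j) * q $ j) - (\<Sum>j\<in>UNIV. q $ j) * real_of_int (b $ i)"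
        by (simp add: c_def algebra_simps sum_subtractf sum_distrib_right)
      then show "(\<Sum>j\<in>UNIV. q $ j *\<^sub>R c j) $ i =
          (map_matrix real_of_int B *v q - (\<chi> i. real_of_int (b $ i))) $ i"
        using q1 by (simp add: matrix_vector_mult_def map_matrix_def)
    qed
    then have "(\<Sum>j\<in>UNIV. q $ j * (a \<bullet> c j)) = 0"
      using Bq by (simp flip: inner_scaleR_right inner_sum_right)
    moreover have "(\<Sum>j\<in>UNIV. q $ j * (a \<bullet> c j)) = (\<Sum>j\<in>S. q $ j * (a \<bullet> c j))"
      using q0 by (intro sum.mono_neutral_right) (auto simp: S_def less_le)
    moreover have "norm (z $ j) powr (q $ j) = exp (q $ j * (a \<bullet> c j)) * norm (w $ j) powr (q $ j)" for j
      unfolding t(2) norm_torus_act[OF t(1)] a_def c_def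
      by (simp add: powr_mult exp_powr_real mult.commute)
    ultimately show ?thesis
      by (simp add: G_def prod.distrib flip: exp_sum)
  qed
  ultimately have "G z = G w" if "z \<in> closure (torus_orbit B b w)" for z
    using that continuous_constant_on_closure[of "torus_orbit B b w" G "G w" z]
    by (metis continuous_on_subset subset_UNIV)
  moreover have "G w \<noteq> 0"
    using supp by (auto simp: G_def S_def)
  moreover have "G 0 = 0"
    using \<open>S \<noteq> {}\<close> by (auto simp: G_def)
  ultimately show ?thesis
    unfolding semistable_def by metis
qed

text \<open>Otherwise a hyperplane separates 0 from the compact convex hull of the shifted weights
  on the support of w, and its normal yields a one-parameter subgroup driving w to 0.\<close>

lemma semistable_imp_weight_hull:
  fixes B :: "int ^ 'm::finite ^ 'd::finite" and w :: "complex ^ 'm"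
  assumes "semistable B b w"
  obtains q where "q \<in> prob_simplex" "\<And>j. w $ j = 0 \<Longrightarrow> q $ j = 0"
    "map_matrix real_of_int B *v q = (\<chi> i. real_of_int (b $ i))"
proof -
  define \<beta> :: "real ^ 'd" where "\<beta> = (\<chi> i. real_of_int (b $ i))"
  define Q where "Q = {q :: real ^ 'm. (\<forall>j. q $ j \<ge> 0) \<and> (\<Sum>j\<in>UNIV. q $ j) = 1 \<and>
    (\<forall>j. w $ j = 0 \<longrightarrow> q $ j = 0)}"
  define K where "K = (\<lambda>q. map_matrix real_of_int B *v q - \<beta>) ` Q"
  have "0 \<in> K"
  proof (rule ccontr)
    assume "0 \<notin> K"
    have "convex Q"
      unfolding Q_def convex_def
      by (auto simp: sum.distrib simp flip: sum_distrib_left)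
    then have "convex ((\<lambda>q. - \<beta> + q) ` (\<lambda>q. map_matrix real_of_int B *v q) ` Q)"
      by (intro convex_translation convex_linear_image) auto
    then have "convex K"
      by (simp add: K_def image_image)
    have "closed Q"
      unfolding Q_def
      by (intro closed_Collect_conj closed_Collect_all closed_Collect_imp closed_Collect_le
          closed_Collect_eq continuous_intros) auto
    moreover have "bounded Q"
    proof (rule boundedI)
      fix q assume "q \<in> Q"
      then show "norm q \<le> 1"
        using norm_le_l1_cart[of q] by (simp add: Q_def)
    qed
    ultimately have "compact Q"
      by (simp add: compact_eq_bounded_closed)
    then have "closed K"
      unfolding K_def
      by (intro compact_imp_closed compact_continuous_image continuous_intros)
    with \<open>convex K\<close> \<open>0 \<notin> K\<close> obtain a e where "e > 0" and a: "\<And>x. x \<in> K \<Longrightarrow> a \<bullet> x > e"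
      using separating_hyperplane_closed_0[of K] by blast
    define c :: "'m \<Rightarrow> real ^ 'd" where "c j = (\<chi> i. real_of_int (B $ i $ j - b $ i))" for j
    have ac: "a \<bullet> c j > 0" if "w $ j \<noteq> 0" for j
    proof -
      \<comment> \<open>The vertices of \<open>Q\<close> give the individual shifted
        weights.\<close>
      have "axis j 1 \<in> Q"
        using that by (auto simp: Q_def axis_def)
      moreover have "c j = map_matrix real_of_int B *v axis j 1 - \<beta>"
        by (simp add: c_def \<beta>_def vec_eq_iff matrix_vector_mult_basis column_def map_matrix_def)
      ultimately show ?thesis
        using a[of "c j"] \<open>e > 0\<close> by (auto simp: K_def)
    qed
    \<comment> \<open>This scales the modulus of coordinate j by
      \<open>exp (- (a \<bullet> c j)) ^ k\<close>, which decays on the support of w; the other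
      coordinates are 0 already.\<close>
    define t :: "nat \<Rightarrow> complex ^ 'd" where "t k = (\<chi> i. of_real (exp (- real k * a $ i)))" for k
    have t: "t k \<in> complex_torus" for k
      by (simp add: t_def complex_torus_def)
    have lnt: "(\<chi> i. ln (norm (t k $ i))) = - real k *\<^sub>R a" for k
      by (simp add: t_def vec_eq_iff)
    have "(\<lambda>k. torus_act B b (t k) w) \<longlonglongrightarrow> 0"
    proof (rule vec_tendstoI)
      fix j
      have "(\<lambda>k. norm (torus_act B b (t k) w $ j)) \<longlonglongrightarrow> 0"
      proof (cases "w $ j = 0")
        case True
        then show ?thesis by (simp add: torus_act_def)
      next
        case False
        have "(\<lambda>k. exp (- (a \<bullet> c j)) ^ k * norm (w $ j)) \<longlonglongrightarrow> 0"
          using ac[OF False] by (intro tendsto_mult_left_zero LIMSEQ_realpow_zero) auto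
        then show ?thesis
          by (simp add: norm_torus_act[OF t] lnt c_def flip: exp_of_nat_mult)
      qed
      then show "(\<lambda>k. torus_act B b (t k) w $ j) \<longlonglongrightarrow> 0 $ j"
        by (simp add: tendsto_norm_zero_iff)
    qed
    moreover have "torus_act B b (t k) w \<in> torus_orbit B b w" for k
      using t by (auto simp: torus_orbit_def)
    ultimately have "0 \<in> closure (torus_orbit B b w)"
      unfolding closure_sequential by (intro exI[of _ "\<lambda>k. torus_act B b (t k) w"]) auto
    then show False
      using assms by (simp add: semistable_def)
  qed
  then obtain q where "q \<in> Q" "map_matrix real_of_int B *v q = \<beta>"
    by (auto simp: K_def)
  then show thesis
    by (intro that[of q]) (auto simp: Q_def prob_simplex_def \<beta>_def)
qed

section \<open>Maximum likelihood estimation in log-linear models\<close>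

text \<open>The difference x - y lies in the kernel of A, hence is orthogonal to every row. This
  lets the log-likelihood on the model be computed from any vector with the same image as u.\<close>

lemma rowspan_inner_eq:
  fixes A :: "int ^ 'm::finite ^ 'd::finite"
  assumes "map_matrix real_of_int A *v x = map_matrix real_of_int A *v y" "r \<in> rowspan A"
  shows "r \<bullet> x = r \<bullet> y"
proof -
  have "map_matrix real_of_int A $ i \<bullet> x = map_matrix real_of_int A $ i \<bullet> y" for i
    using assms(1) by (metis matrix_vector_mul_component)
  then have "orthogonal (x - y) s" if "s \<in> rows (map_matrix real_of_int A)" for s
    using that
    by (auto simp: orthogonal_def rows_def row_def inner_diff_left inner_commute
        simp del: nth_map_matrix)
  then have "orthogonal (x - y) r"
    using assms(2) orthogonal_to_span unfolding rowspan_def by blast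
  then show ?thesis
    by (simp add: orthogonal_def inner_diff_left inner_diff_right inner_commute)
qed

lemma subspace_rowspan: "subspace (rowspan A)"
  by (simp add: rowspan_def)

lemma row_in_rowspan: "map_matrix real_of_int A $ i \<in> rowspan A"
  unfolding rowspan_def by (rule span_base) (auto simp: rows_def row_def map_matrix_def)

lemma ln_likelihood:
  assumes "\<And>j. p $ j > 0"
  shows "ln (likelihood u p) = (\<chi> j. ln (p $ j)) \<bullet> (\<chi> j. real (u $ j))"
  using assms
  by (simp add: likelihood_def inner_vec_def ln_prod ln_realpow less_imp_neq[THEN not_sym] mult.commute)

lemma likelihood_pos:
  assumes "\<And>j. p $ j > 0"
  shows "likelihood u p > 0"
  unfolding likelihood_def using assms by (intro prod_pos) auto

lemma is_MLE_iff:
  "is_MLE A u p \<longleftrightarrow> p \<in> log_linear_model A \<and>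
    (\<forall>q\<in>log_linear_model A. (\<chi> j. ln (q $ j)) \<bullet> (\<chi> j. real (u $ j)) \<le>
      (\<chi> j. ln (p $ j)) \<bullet> (\<chi> j. real (u $ j)))"
proof -
  have "likelihood u q \<le> likelihood u p \<longleftrightarrow> (\<chi> j. ln (q $ j)) \<bullet> (\<chi> j. real (u $ j)) \<le>
      (\<chi> j. ln (p $ j)) \<bullet> (\<chi> j. real (u $ j))"
    if "p \<in> log_linear_model A" "q \<in> log_linear_model A" for q
    using that by (simp add: log_linear_model_def likelihood_pos flip: ln_likelihood)
  then show ?thesis
    unfolding is_MLE_def is_arg_max_def by (auto simp: not_less)
qed

text \<open>Move \<open>ln p\<close> in a direction r of the row span and renormalize: the path
  stays in the model, so the log-likelihood has derivative 0 at p. Taking r to be each row of A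
  gives the equation.\<close>

lemma MLE_critical:
  fixes A :: "int ^ 'm::finite ^ 'd::finite" and u :: "nat ^ 'm"
  assumes one: "(\<chi> j. 1) \<in> rowspan A" and "is_MLE A u p"
  shows "map_matrix real_of_int A *v (\<chi> j. real (u $ j)) =
    map_matrix real_of_int A *v (real (\<Sum>j\<in>UNIV. u $ j) *\<^sub>R p)"
proof -
  define n where "n = real (\<Sum>j\<in>UNIV. u $ j)"
  have p: "p \<in> log_linear_model A" and max: "\<And>q. q \<in> log_linear_model A \<Longrightarrow>
      (\<chi> j. ln (q $ j)) \<bullet> (\<chi> j. real (u $ j)) \<le> (\<chi> j. ln (p $ j)) \<bullet> (\<chi> j. real (u $ j))"
    using assms(2) by (auto simp: is_MLE_iff)
  have pos: "p $ j > 0" and sum1: "(\<Sum>j\<in>UNIV. p $ j) = 1" 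
    and lnp: "(\<chi> j. ln (p $ j)) \<in> rowspan A" for j
    using p by (auto simp: log_linear_model_def prob_simplex_def)
  have crit: "r \<bullet> (\<chi> j. real (u $ j)) = n * (r \<bullet> p)" if r: "r \<in> rowspan A" for r
  proof -
    define Z where "Z s = (\<Sum>j\<in>UNIV. p $ j * exp (s * r $ j))" for s
    define q :: "real \<Rightarrow> real ^ 'm" where "q s = (\<chi> j. p $ j * exp (s * r $ j) / Z s)" for s
    define f where "f s = (\<chi> j. ln (p $ j)) \<bullet> (\<chi> j. real (u $ j)) +
      s * (r \<bullet> (\<chi> j. real (u $ j))) - n * ln (Z s)" for s
    have Z: "Z s > 0" for s
      unfolding Z_def using pos by (intro sum_pos) auto
    \<comment> \<open>Normalizing by \<open>Z s\<close> shifts the logarithm by a multiple of the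
      all-ones vector, which lies in the row span by \<open>one\<close>.\<close>
    have lnq: "(\<chi> j. ln (q s $ j)) = (\<chi> j. ln (p $ j)) + s *\<^sub>R r - ln (Z s) *\<^sub>R (\<chi> j. 1)" for s
      using pos Z by (simp add: q_def vec_eq_iff ln_mult ln_div less_imp_neq[THEN not_sym])
    have "(\<Sum>j\<in>UNIV. q s $ j) = 1" for s
      using Z[of s] by (simp add: q_def Z_def flip: sum_divide_distrib)
    moreover have "q s $ j > 0" for s j
      using pos Z by (simp add: q_def)
    moreover have "(\<chi> j. ln (q s $ j)) \<in> rowspan A" for s
      unfolding lnq using subspace_rowspan[of A] one r lnp
      by (intro subspace_diff subspace_add subspace_scale)
    ultimately have "q s \<in> log_linear_model A" for s
      by (auto simp: log_linear_model_def prob_simplex_def less_imp_le)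
    moreover have "(\<chi> j. ln (q s $ j)) \<bullet> (\<chi> j. real (u $ j)) = f s" for s
      unfolding lnq by (simp add: f_def n_def inner_diff_left inner_add_left) (simp add: inner_vec_def)
    moreover have "f 0 = (\<chi> j. ln (p $ j)) \<bullet> (\<chi> j. real (u $ j))"
      by (simp add: f_def Z_def sum1)
    ultimately have "f s \<le> f 0" for s
      using max[of "q s"] by simp
    \<comment> \<open>Here \<open>Z 0 = 1\<close> and the derivative of \<open>Z\<close> at 0 is
      \<open>r \<bullet> p\<close>.\<close>
    moreover have "(f has_real_derivative r \<bullet> (\<chi> j. real (u $ j)) - n * (r \<bullet> p)) (at 0)"
    proof -
      have "(Z has_real_derivative r \<bullet> p) (at 0)"
        unfolding Z_def
        by (auto intro!: derivative_eq_intros simp: inner_vec_def mult.commute)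
      then show ?thesis
        unfolding f_def using Z[of 0]
        by (auto intro!: derivative_eq_intros simp: Z_def[of 0] sum1)
    qed
    ultimately have "r \<bullet> (\<chi> j. real (u $ j)) - n * (r \<bullet> p) = 0"
      by (intro DERIV_local_max[of f _ 0 1]) auto
    then show ?thesis by simp
  qed
  show ?thesis
    by (simp add: vec_eq_iff matrix_vector_mul_component crit[OF row_in_rowspan] n_def)
qed

text \<open>Zero counts leave coordinates of p uncontrolled, but with v in place of u every
  coordinate is bounded away from 0 on a superlevel set.\<close>

lemma MLE_exists:
  fixes A :: "int ^ 'm::finite ^ 'd::finite" and u :: "nat ^ 'm" and v :: "real ^ 'm"
  assumes one: "(\<chi> j. 1) \<in> rowspan A" and vpos: "\<And>j. v $ j > 0"
    and Av: "map_matrix real_of_int A *v v = map_matrix real_of_int A *v (\<chi> j. real (u $ j))"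
  shows "\<exists>p. is_MLE A u p"
proof -
  define l where "l p = (\<chi> j. ln (p $ j)) \<bullet> v" for p :: "real ^ 'm"
  have l: "(\<chi> j. ln (p $ j)) \<bullet> (\<chi> j. real (u $ j)) = l p" if "p \<in> log_linear_model A" for p
    using that rowspan_inner_eq[OF Av] by (simp add: l_def log_linear_model_def)
  \<comment> \<open>The uniform distribution lies in the model because its logarithm is a multiple
    of the all-ones vector; it fixes the reference level.\<close>
  define p0 :: "real ^ 'm" where "p0 = (\<chi> j. 1 / real CARD('m))"
  have "(\<chi> j. ln (p0 $ j)) = ln (1 / real CARD('m)) *\<^sub>R (\<chi> j. 1)"
    by (simp add: p0_def vec_eq_iff)
  then have "(\<chi> j. ln (p0 $ j)) \<in> rowspan A"
    using subspace_scale[OF subspace_rowspan one] by metis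
  then have p0: "p0 \<in> log_linear_model A"
    by (simp add: log_linear_model_def prob_simplex_def p0_def)
  \<comment> \<open>All summands \<open>ln (p $ j) * v $ j\<close> are nonpositive on the model, so
    \<open>l p \<ge> l p0\<close> bounds each one below by \<open>l p0\<close>; solving for
    \<open>p $ j\<close> gives this constant.\<close>
  define \<epsilon> where "\<epsilon> j = exp (l p0 / v $ j)" for j
  have \<epsilon>: "\<epsilon> j > 0" for j by (simp add: \<epsilon>_def)
  define C where "C = {p :: real ^ 'm. (\<forall>j. \<epsilon> j \<le> p $ j) \<and> (\<Sum>j\<in>UNIV. p $ j) = 1}"
  \<comment> \<open>The lower bounds keep the logarithm continuous on \<open>C\<close>, so
    \<open>K\<close> is closed although the model need not be.\<close>
  define K where "K = C \<inter> (\<lambda>p. \<chi> j. ln (p $ j)) -` rowspan A"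
  have C: "p $ j > 0" if "p \<in> C" for p j
    using that \<epsilon>[of j] by (auto simp: C_def intro: less_le_trans)
  have contln: "continuous_on C (\<lambda>p. \<chi> j. ln (p $ j))"
    using C by (intro continuous_on_vec_lambda continuous_intros) (auto simp: less_imp_neq[THEN not_sym])
  have "closed C"
    unfolding C_def
    by (intro closed_Collect_conj closed_Collect_all closed_Collect_le closed_Collect_eq
        continuous_intros)
  then have "closed K"
    unfolding K_def by (intro continuous_closed_preimage[OF contln])
      (auto simp: rowspan_def)
  moreover have "bounded K"
  proof (rule boundedI)
    fix p assume "p \<in> K"
    then show "norm p \<le> 1"
      using norm_le_l1_cart[of p] C[of p] by (simp add: K_def C_def less_imp_le abs_of_pos)
  qed
  ultimately have "compact K"
    by (simp add: compact_eq_bounded_closed)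
  have K: "p \<in> K" if p: "p \<in> log_linear_model A" and "l p \<ge> l p0" for p
  proof -
    have pos: "p $ j > 0" and sum1: "(\<Sum>j\<in>UNIV. p $ j) = 1" for j
      using p by (auto simp: log_linear_model_def prob_simplex_def)
    have "p $ j \<le> 1" for j
      using sum1 pos member_le_sum[of j UNIV "\<lambda>j. p $ j"] by (simp add: less_imp_le)
    then have neg: "ln (p $ j) * v $ j \<le> 0" for j
      using pos[of j] vpos[of j] by (simp add: mult_nonpos_nonneg)
    have "\<epsilon> j \<le> p $ j" for j
    proof -
      have "l p \<le> ln (p $ j) * v $ j"
        using neg sum_nonpos[of "UNIV - {j}" "\<lambda>j. ln (p $ j) * v $ j"]
        by (simp add: l_def inner_vec_def sum.remove[of UNIV j])
      then have "l p0 / v $ j \<le> ln (p $ j)"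
        using \<open>l p \<ge> l p0\<close> vpos[of j] by (simp add: divide_le_eq)
      then show ?thesis
        using pos[of j] by (simp add: \<epsilon>_def ln_ge_iff)
    qed
    then show ?thesis
      using p sum1 by (simp add: K_def C_def log_linear_model_def)
  qed
  have "K \<subseteq> log_linear_model A"
    using C by (auto simp: K_def log_linear_model_def prob_simplex_def C_def less_imp_le)
  have "K \<noteq> {}" using K[OF p0] by auto
  moreover have "continuous_on K l"
    unfolding l_def K_def
    by (intro continuous_on_inner continuous_on_const continuous_on_subset[OF contln]) auto
  ultimately obtain p where "p \<in> K" and max: "\<And>q. q \<in> K \<Longrightarrow> l q \<le> l p"
    using continuous_attains_sup[OF \<open>compact K\<close>] by blast
  have "l q \<le> l p" if "q \<in> log_linear_model A" for q
    using max[of q] max[of p0] K[OF p0] K[OF that] by linarith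
  then have "is_MLE A u p"
    using \<open>p \<in> K\<close> \<open>K \<subseteq> log_linear_model A\<close> by (auto simp: is_MLE_iff l)
  then show ?thesis by blast
qed

theorem proposition4p4:
  fixes A :: "int ^ 'm::finite ^ 'd::finite" and u :: "nat ^ 'm" and n :: nat
  assumes "n = (\<Sum>j\<in>UNIV. u $ j)" and "n \<ge> 1"
    and "(\<chi> j. 1) \<in> rowspan A"
  shows "(\<exists>p. is_MLE A u p) \<longleftrightarrow>
    (\<exists>b :: int ^ 'd.
       (\<exists>v :: real ^ 'm. (\<forall>j. v $ j > 0) \<and>
          (\<chi> i. real_of_int (b $ i)) = map_matrix real_of_int A *v v) \<and>
       semistable (\<chi> i j. int n * A $ i $ j) b (\<chi> j. of_nat (u $ j)))"
    (is "?L \<longleftrightarrow> ?R")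
proof
  let ?A = "map_matrix real_of_int A"
  let ?u = "(\<chi> j. real (u $ j)) :: real ^ 'm"
  \<comment> \<open>The factor n rescales probability vectors to vectors of counts.\<close>
  have nA: "map_matrix real_of_int (\<chi> i j. int n * A $ i $ j) *v q = ?A *v (real n *\<^sub>R q)" for q
    by (simp add: vec_eq_iff matrix_vector_mult_def map_matrix_def mult_ac)
  show ?R if ?L
  proof -
    from that obtain p where p: "is_MLE A u p" ..
    \<comment> \<open>The critical equation rewrites A u as the image of the positive vector n p,
      while u / n gives convex coefficients supported where u is nonzero.\<close>
    define b :: "int ^ 'd" where "b = A *v (\<chi> j. int (u $ j))"
    have b: "(\<chi> i. real_of_int (b $ i)) = ?A *v ?u"
      by (simp add: b_def vec_eq_iff matrix_vector_mult_def map_matrix_def)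
    also have "\<dots> = ?A *v (real n *\<^sub>R p)"
      using MLE_critical[OF assms(3) p] assms(1) by simp
    finally have "(\<chi> i. real_of_int (b $ i)) = ?A *v (real n *\<^sub>R p)" .
    moreover have "(real n *\<^sub>R p) $ j > 0" for j
      using p \<open>n \<ge> 1\<close> by (simp add: is_MLE_iff log_linear_model_def)
    moreover have "semistable (\<chi> i j. int n * A $ i $ j) b (\<chi> j. of_nat (u $ j))"
    proof (rule weight_hull_imp_semistable)
      show "(1 / real n) *\<^sub>R ?u \<in> prob_simplex"
        using \<open>n \<ge> 1\<close> unfolding prob_simplex_def
        by (simp add: assms(1) del: sum_eq_0_iff flip: sum_divide_distrib of_nat_sum)
      show "map_matrix real_of_int (\<chi> i j. int n * A $ i $ j) *v ((1 / real n) *\<^sub>R ?u) =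
          (\<chi> i. real_of_int (b $ i))"
        unfolding nA b using \<open>n \<ge> 1\<close> by simp
    qed simp
    ultimately show ?thesis by blast
  qed
  show ?L if ?R
  proof -
    from that obtain b v where v: "\<And>j. v $ j > 0" and bv: "(\<chi> i. real_of_int (b $ i)) = ?A *v v"
      and ss: "semistable (\<chi> i j. int n * A $ i $ j) b (\<chi> j. of_nat (u $ j))"
      by blast
    obtain q where q: "\<And>j. u $ j = 0 \<Longrightarrow> q $ j = 0" "?A *v (real n *\<^sub>R q) = ?A *v v"
      using semistable_imp_weight_hull[OF ss] by (auto simp: nA bv)
    define w where "w = real n *\<^sub>R q"
    \<comment> \<open>Where u vanishes so does w, leaving e times a positive entry of v; elsewhere
      the entry tends to a positive count.\<close>
    have "\<forall>\<^sub>F e in at_right 0. 0 < (?u + e *\<^sub>R (v - w)) $ j" for j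
    proof (cases "u $ j = 0")
      case True
      then have "w $ j = 0" using q(1) by (simp add: w_def)
      then show ?thesis
        using True v[of j] by (auto intro: eventually_mono[OF eventually_at_right_less])
    next
      case False
      have "((\<lambda>e. (?u + e *\<^sub>R (v - w)) $ j) \<longlongrightarrow> (?u + 0 *\<^sub>R (v - w)) $ j) (at_right 0)"
        by (intro tendsto_intros)
      then show ?thesis
        using False by (intro order_tendstoD) auto
    qed
    then have "\<forall>\<^sub>F e in at_right 0. \<forall>j. 0 < (?u + e *\<^sub>R (v - w)) $ j"
      by (simp add: eventually_all_finite)
    then obtain e where e: "\<And>j. 0 < (?u + e *\<^sub>R (v - w)) $ j"
      using eventually_happens[of _ "at_right (0 :: real)"] by auto
    \<comment> \<open>The perturbation v - w lies in the kernel of A, as both vectors map to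
      b.\<close>
    have "?A *v (?u + e *\<^sub>R (v - w)) = ?A *v ?u"
      using q(2) by (simp add: w_def matrix_vector_right_distrib matrix_vector_mult_diff_distrib
          matrix_vector_mult_scaleR)
    then show ?L
      by (rule MLE_exists[OF assms(3) e])
  qed
qed

end
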